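(* Consider the algorithm dist-EF-SGD (described in the context) with $M\ge1$ workers, a $\delta$-compressor $\mathcal C$ with $\delta\in(0,1)$, and an arbitrary sequence of learning rates $\{\eta_t\}$ with $\eta_{-1}=0$ and $\eta_t>0$ for $t\ge0$. Suppose Assumptions 2 and 3 in the context hold, and let $G^2=\sigma^2+\omega^2$ (so that $\mathbf E_t[\lVert g_{t,i}\rVert^2]\le G^2$) and $\alpha=1-\frac\delta2$. Then for every $t\ge0$, $$\mathbf E\left[\left\lVert\tilde e_{t+1}+\frac1M\sum_{i=1}^M e_{t+1,i}\right\rVert^2\right]\le\frac{2(1-\delta)(2-\delta)G^2}{\delta}\sum_{k=0}^{t}\frac{\eta_{t-k}^2}{\eta_t^2}\alpha^k+\frac{4(1-\delta)(2-\delta)^3G^2}{\delta^2}\sum_{j=0}^{t}\alpha^{t-j}\sum_{k=0}^{j}\frac{\eta_{j-k}^2}{\eta_t^2}\alpha^k .$$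
   Context: $\lVert\cdot\rVert$ is the Euclidean norm on $\mathbb R^d$. Compressor: a (possibly randomized) operator $\mathcal C:\mathbb R^d\to\mathbb R^d$ is a $\delta$-compressor, $\delta\in(0,1)$, if $\mathbf E_{\mathcal C}\lVert\mathcal C(x)-x\rVert^2\le(1-\delta)\lVert x\rVert^2$ for all $x\in\mathbb R^d$, the expectation being over the randomness of $\mathcal C$ (in the algorithm, this bound holds conditionally on the input of each application of $\mathcal C$). Loss: given a loss function $\mathcal L(x,\xi)$, $f(x)=\mathbf E_\xi[\mathcal L(x,\xi)]$ is assumed differentiable, where $x\in\mathbb R^d$ and $\xi$ is a data batch drawn from some unknown distribution. Algorithm dist-EF-SGD. Inputs: $\mathcal L$, learning rates $\{\eta_t\}$ with $\eta_{-1}=0$, number of workers $M$, compressor $\mathcal C$. Initialize $x_0\in\mathbb R^d$, $e_{0,i}=0\in\mathbb R^d$ for each worker $i=1,\dots,M$, and $\tilde e_0=0\in\mathbb R^d$ on the server. For $t=0,1,2,\dots$: each worker $i$ picks data $\xi_{t,i}$ and computes $g_{t,i}=\nabla\mathcal L(x_t,\xi_{t,i})$ (gradient in $x$), $p_{t,i}=g_{t,i}+\frac{\eta_{t-1}}{\eta_t}e_{t,i}$, $\Delta_{t,i}=\mathcal C(p_{t,i})$, $e_{t+1,i}=p_{t,i}-\Delta_{t,i}$; the server computes $\tilde p_t=\frac1M\sum_{i=1}^M\Delta_{t,i}+\frac{\eta_{t-1}}{\eta_t}\tilde e_t$, $\tilde\Delta_t=\mathcal C(\tilde p_t)$, $\tilde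 e_{t+1}=\tilde p_t-\tilde\Delta_t$; and all workers update $x_{t+1}=x_t-\eta_t\tilde\Delta_t$. $\mathbf E_t$ denotes expectation at iteration $t$, i.e. conditional on everything that happened before iteration $t$; $\mathbf E$ is total expectation. Assumption 2: $\mathbf E_t[g_{t,i}]=\nabla f(x_t)$ and $\mathbf E_t[\lVert g_{t,i}-\nabla f(x_t)\rVert^2]\le\sigma^2$ for all $t,i$. Assumption 3: $\lVert\nabla f(x_t)\rVert^2\le\omega^2$ for all $t$. *)

theory Defs
  imports "HOL-Probability.Probability"
begin

text \<open>A randomized operator is a map \<open>C :: 's \<Rightarrow> real^'d \<Rightarrow> real^'d\<close> whose first argument is a random
  seed with law \<open>S\<close>; \<open>\<integral>\<^sup>+ s. _ \<partial>S\<close> is the expectation over the randomness of the operator.\<close>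

definition delta_compressor ::
  "real \<Rightarrow> 's measure \<Rightarrow> ('s \<Rightarrow> real^'d \<Rightarrow> real^'d) \<Rightarrow> bool" where
  "delta_compressor \<delta> S C \<longleftrightarrow>
     (\<forall>x. (\<integral>\<^sup>+ s. ennreal ((norm (C s x - x))\<^sup>2) \<partial>S) \<le> ennreal ((1 - \<delta>) * (norm x)\<^sup>2))"

text \<open>The compressor bound for one application of \<open>C\<close> inside a random experiment \<open>P\<close>, with random
  input \<open>p\<close> and random seed \<open>\<zeta>\<close>, conditionally on the \<open>\<sigma>\<close>-algebra generated by the input.\<close>

definition compresses_given_input ::
  "'w measure \<Rightarrow> real \<Rightarrow> ('s \<Rightarrow> real^'d \<Rightarrow> real^'d) \<Rightarrow> ('w \<Rightarrow> 's) \<Rightarrow> ('w \<Rightarrow> real^'d) \<Rightarrow> bool" where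
  "compresses_given_input P \<delta> C \<zeta> p \<longleftrightarrow>
     (AE u in P. nn_cond_exp P (vimage_algebra (space P) p borel)
                   (\<lambda>u. ennreal ((norm (C (\<zeta> u) (p u) - p u))\<^sup>2)) u
                 \<le> ennreal ((1 - \<delta>) * (norm (p u))\<^sup>2))"

definition expected_loss :: "'z measure \<Rightarrow> (real^'d \<Rightarrow> 'z \<Rightarrow> real) \<Rightarrow> real^'d \<Rightarrow> real" where
  "expected_loss D L x = (\<integral>z. L x z \<partial>D)"

text \<open>A run of dist-EF-SGD on the probability space \<open>P\<close>. The random inputs of iteration \<open>t\<close> are
  the data batches \<open>\<xi> t i\<close> (law \<open>D\<close>) and the compressor seeds \<open>\<zeta> t i\<close> of worker \<open>i\<close> and
  \<open>\<zeta>s t\<close> of the server (law \<open>S\<close>); no independence is imposed on them. All other processes are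
  determined by these inputs: \<open>e\<close>, \<open>es\<close> are the worker and server errors, and \<open>p\<close>, \<open>\<Delta>\<close>, \<open>ps\<close>, \<open>\<Delta>s\<close>
  the inputs and outputs of the worker and server compressions. The learning rates are indexed
  by \<open>int\<close> because of the convention \<open>\<eta> (-1) = 0\<close>.\<close>

locale dist_ef_sgd = P: prob_space P + D: prob_space D + S: prob_space S
  for P :: "'w measure" and D :: "'z measure" and S :: "'s measure" +
  fixes L :: "real^'d \<Rightarrow> 'z \<Rightarrow> real"
    and grad_f :: "real^'d \<Rightarrow> real^'d"
    and C :: "'s \<Rightarrow> real^'d \<Rightarrow> real^'d"
    and \<eta> :: "int \<Rightarrow> real"
    and M :: nat
    and \<xi> :: "nat \<Rightarrow> nat \<Rightarrow> 'w \<Rightarrow> 'z"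
    and \<zeta> :: "nat \<Rightarrow> nat \<Rightarrow> 'w \<Rightarrow> 's"
    and \<zeta>s :: "nat \<Rightarrow> 'w \<Rightarrow> 's"
    and x0 :: "real^'d"
    and x :: "nat \<Rightarrow> 'w \<Rightarrow> real^'d"
    and g p \<Delta> e :: "nat \<Rightarrow> nat \<Rightarrow> 'w \<Rightarrow> real^'d"
    and ps \<Delta>s es :: "nat \<Rightarrow> 'w \<Rightarrow> real^'d"
  assumes L_measurable: "(\<lambda>(y, z). L y z) \<in> borel_measurable (borel \<Otimes>\<^sub>M D)"
    and L_integrable: "\<And>y. integrable D (L y)"
    and f_gradient: "\<And>y. GDERIV (expected_loss D L) y :> grad_f y"
    and C_measurable: "(\<lambda>(s, y). C s y) \<in> borel_measurable (S \<Otimes>\<^sub>M borel)"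
    and \<xi>_measurable: "\<And>t i. i \<in> {1..M} \<Longrightarrow> \<xi> t i \<in> measurable P D"
    and \<xi>_law: "\<And>t i. i \<in> {1..M} \<Longrightarrow> distr P D (\<xi> t i) = D"
    and \<zeta>_measurable: "\<And>t i. i \<in> {1..M} \<Longrightarrow> \<zeta> t i \<in> measurable P S"
    and \<zeta>_law: "\<And>t i. i \<in> {1..M} \<Longrightarrow> distr P S (\<zeta> t i) = S"
    and \<zeta>s_measurable: "\<And>t. \<zeta>s t \<in> measurable P S"
    and \<zeta>s_law: "\<And>t. distr P S (\<zeta>s t) = S"
    and x_init: "\<And>u. u \<in> space P \<Longrightarrow> x 0 u = x0"
    and e_init: "\<And>i u. i \<in> {1..M} \<Longrightarrow> u \<in> space P \<Longrightarrow> e 0 i u = 0"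
    and es_init: "\<And>u. u \<in> space P \<Longrightarrow> es 0 u = 0"
    and g_eq: "\<And>t i u. i \<in> {1..M} \<Longrightarrow> u \<in> space P \<Longrightarrow>
                 GDERIV (\<lambda>y. L y (\<xi> t i u)) (x t u) :> g t i u"
    and p_eq: "\<And>t i u. i \<in> {1..M} \<Longrightarrow> u \<in> space P \<Longrightarrow>
                 p t i u = g t i u + (\<eta> (int t - 1) / \<eta> (int t)) *\<^sub>R e t i u"
    and \<Delta>_eq: "\<And>t i u. i \<in> {1..M} \<Longrightarrow> u \<in> space P \<Longrightarrow> \<Delta> t i u = C (\<zeta> t i u) (p t i u)"
    and e_eq: "\<And>t i u. i \<in> {1..M} \<Longrightarrow> u \<in> space P \<Longrightarrow> e (Suc t) i u = p t i u - \<Delta> t i u"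
    and ps_eq: "\<And>t u. u \<in> space P \<Longrightarrow>
                 ps t u = (1 / real M) *\<^sub>R (\<Sum>i=1..M. \<Delta> t i u)
                          + (\<eta> (int t - 1) / \<eta> (int t)) *\<^sub>R es t u"
    and \<Delta>s_eq: "\<And>t u. u \<in> space P \<Longrightarrow> \<Delta>s t u = C (\<zeta>s t u) (ps t u)"
    and es_eq: "\<And>t u. u \<in> space P \<Longrightarrow> es (Suc t) u = ps t u - \<Delta>s t u"
    and x_eq: "\<And>t u. u \<in> space P \<Longrightarrow> x (Suc t) u = x t u - \<eta> (int t) *\<^sub>R \<Delta>s t u"

text \<open>The \<open>\<sigma>\<close>-algebra of everything that happened before iteration \<open>t\<close>: it is generated by all
  data and all compressor seeds used in the iterations \<open>s < t\<close>.\<close>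

definition history ::
  "'w measure \<Rightarrow> 'z measure \<Rightarrow> 's measure \<Rightarrow> nat \<Rightarrow> (nat \<Rightarrow> nat \<Rightarrow> 'w \<Rightarrow> 'z) \<Rightarrow>
   (nat \<Rightarrow> nat \<Rightarrow> 'w \<Rightarrow> 's) \<Rightarrow> (nat \<Rightarrow> 'w \<Rightarrow> 's) \<Rightarrow> nat \<Rightarrow> 'w measure" where
  "history P D S M \<xi> \<zeta> \<zeta>s t = sigma (space P)
     (\<Union>s<t. (\<Union>i\<in>{1..M}. sets (vimage_algebra (space P) (\<xi> s i) D) \<union>
                          sets (vimage_algebra (space P) (\<zeta> s i) S)) \<union>
             sets (vimage_algebra (space P) (\<zeta>s s) S))"

text \<open>\<open>real_cond_exp\<close> is available for real-valued random variables only, so the conditional mean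
  of a random vector is expressed componentwise.\<close>

definition has_cond_mean ::
  "'w measure \<Rightarrow> 'w measure \<Rightarrow> ('w \<Rightarrow> real^'d) \<Rightarrow> ('w \<Rightarrow> real^'d) \<Rightarrow> bool" where
  "has_cond_mean P F X Y \<longleftrightarrow> integrable P X \<and>
     (\<forall>k. AE u in P. real_cond_exp P F (\<lambda>u. X u $ k) u = Y u $ k)"

definition unbiased_bounded_variance ::
  "'w measure \<Rightarrow> (nat \<Rightarrow> 'w measure) \<Rightarrow> nat \<Rightarrow> real \<Rightarrow> (real^'d \<Rightarrow> real^'d) \<Rightarrow>
   (nat \<Rightarrow> 'w \<Rightarrow> real^'d) \<Rightarrow> (nat \<Rightarrow> nat \<Rightarrow> 'w \<Rightarrow> real^'d) \<Rightarrow> bool" where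
  "unbiased_bounded_variance P F M \<sigma> grad_f x g \<longleftrightarrow>
     (\<forall>t. \<forall>i\<in>{1..M}.
        has_cond_mean P (F t) (g t i) (\<lambda>u. grad_f (x t u)) \<and>
        (AE u in P. nn_cond_exp P (F t) (\<lambda>u. ennreal ((norm (g t i u - grad_f (x t u)))\<^sup>2)) u
                    \<le> ennreal (\<sigma>\<^sup>2)))"

definition bounded_gradient ::
  "'w measure \<Rightarrow> real \<Rightarrow> (real^'d \<Rightarrow> real^'d) \<Rightarrow> (nat \<Rightarrow> 'w \<Rightarrow> real^'d) \<Rightarrow> bool" where
  "bounded_gradient P \<omega> grad_f x \<longleftrightarrow> (\<forall>t. AE u in P. (norm (grad_f (x t u)))\<^sup>2 \<le> \<omega>\<^sup>2)"

end

theory Submission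
  imports Defs
begin

text \<open>A compression error is a contraction in mean square: if the input \<open>p\<close> has second moment at most
  \<open>B\<close>, then \<open>p - C p\<close> has second moment at most \<open>(1 - \<delta>) B\<close>. Error feedback rescales the error and
  adds it to the next input, and the learning rates enter only through the factors
  \<open>\<eta>\<^bsub>t-1\<^esub> / \<eta>\<^bsub>t\<^esub>\<close>. The input of the next compression is \<open>v + c e\<close> with a new signal \<open>v\<close> and a carried
  error \<open>e\<close>, and Young's inequality with parameter \<open>\<gamma> = \<delta> / (2 (1 - \<delta>))\<close> separates the two: this
  choice turns the contraction factor \<open>1 - \<delta>\<close> into \<open>(1 + \<gamma>) (1 - \<delta>) = 1 - \<delta> / 2 = \<alpha>\<close>, which
  is still less than one, and multiplies the signal by \<open>1 + 1 / \<gamma> = (2 - \<delta>) / \<delta>\<close>. Unrolling the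
  recursion gives a sum that is geometric in \<open>\<alpha>\<close>, in which the factors
  \<open>\<eta>\<^bsub>s-1\<^esub>\<^sup>2 / \<eta>\<^bsub>s\<^esub>\<^sup>2\<close> telescope. This is
  \<open>error_feedback_second_moment\<close>, and it bounds the compressor input rather than the error.

  The lemma applies twice. For a worker the signals are the stochastic gradients, whose second
  moment is at most \<open>G\<^sup>2\<close> (\<open>second_moment_le_cond_mean\<close>); the result \<open>W\<^bsub>t\<^esub>\<close> bounds the second moment
  of the worker's compressor input, hence \<open>(1 - \<delta>) W\<^bsub>t\<^esub>\<close> that of its error and
  \<open>2 (2 - \<delta>) W\<^bsub>t\<^esub>\<close> that of its output. For the server the signals are the averages of these
  outputs, so the same lemma with \<open>2 (2 - \<delta>) W\<^bsub>j\<^esub>\<close> in place of \<open>G\<^sup>2\<close> yields the double sum. The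
  two errors are finally combined by \<open>\<parallel>a + b\<parallel>\<^sup>2 \<le> 2 \<parallel>a\<parallel>\<^sup>2 + 2 \<parallel>b\<parallel>\<^sup>2\<close>. Averages over the
  workers are handled by convexity of the squared norm, so the number of workers does not enter the bound.\<close>

section \<open>Second moments of random vectors\<close>

text \<open>Integrability belongs to the predicate because the integral of a function that is not
  integrable is \<open>0\<close>, so that the inequality alone would say nothing.\<close>

definition second_moment_le ::
  "'w measure \<Rightarrow> ('w \<Rightarrow> 'a::euclidean_space) \<Rightarrow> real \<Rightarrow> bool" where
  "second_moment_le P X B \<longleftrightarrow> X \<in> borel_measurable P \<and>
     integrable P (\<lambda>u. (norm (X u))\<^sup>2) \<and> (\<integral>u. (norm (X u))\<^sup>2 \<partial>P) \<le> B"

lemma second_moment_le_dominated: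
  fixes X :: "'w \<Rightarrow> 'a::euclidean_space"
  assumes X: "X \<in> borel_measurable P" and h: "integrable P h"
    and le: "AE u in P. (norm (X u))\<^sup>2 \<le> h u" and B: "(\<integral>u. h u \<partial>P) \<le> B"
  shows "second_moment_le P X B"
proof -
  have int: "integrable P (\<lambda>u. (norm (X u))\<^sup>2)"
    by (rule Bochner_Integration.integrable_bound[OF h]) (use X le in \<open>auto elim!: eventually_mono\<close>)
  show ?thesis
    unfolding second_moment_le_def using X int integral_mono_AE[OF int h le] B by linarith
qed

lemma second_moment_le_cong:
  assumes "\<And>u. u \<in> space P \<Longrightarrow> X u = Y u"
  shows "second_moment_le P X B \<longleftrightarrow> second_moment_le P Y B"
proof -
  have "X \<in> borel_measurable P \<longleftrightarrow> Y \<in> borel_measurable P"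
    by (rule measurable_cong) (rule assms)
  moreover have "integrable P (\<lambda>u. (norm (X u))\<^sup>2) \<longleftrightarrow> integrable P (\<lambda>u. (norm (Y u))\<^sup>2)"
    by (rule Bochner_Integration.integrable_cong) (simp_all add: assms)
  moreover have "(\<integral>u. (norm (X u))\<^sup>2 \<partial>P) = (\<integral>u. (norm (Y u))\<^sup>2 \<partial>P)"
    by (rule Bochner_Integration.integral_cong) (simp_all add: assms)
  ultimately show ?thesis by (simp add: second_moment_le_def)
qed

text \<open>Young's inequality. The parameter \<open>\<gamma>\<close> trades the weight of the two summands: \<open>\<gamma> = 1\<close> gives the
  symmetric bound by twice the sum, while in the error feedback recursion \<open>\<gamma>\<close> is taken so
  small that \<open>1 + \<gamma>\<close>, the factor of the carried error \<open>Y\<close>, does not undo the contraction by the compressor.\<close>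

lemma second_moment_le_add_scaleR:
  fixes X Y :: "'w \<Rightarrow> 'a::euclidean_space"
  assumes X: "second_moment_le P X A" and Y: "second_moment_le P Y B" and \<gamma>: "\<gamma> > 0"
  shows "second_moment_le P (\<lambda>u. X u + c *\<^sub>R Y u) ((1 + 1 / \<gamma>) * A + (1 + \<gamma>) * c\<^sup>2 * B)"
proof (rule second_moment_le_dominated)
  have [measurable]: "X \<in> borel_measurable P" "Y \<in> borel_measurable P"
    using X Y by (simp_all add: second_moment_le_def)
  show "(\<lambda>u. X u + c *\<^sub>R Y u) \<in> borel_measurable P" by measurable
  show "integrable P (\<lambda>u. (1 + 1 / \<gamma>) * (norm (X u))\<^sup>2 + (1 + \<gamma>) * c\<^sup>2 * (norm (Y u))\<^sup>2)"
    using X Y by (simp add: second_moment_le_def)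
  have "(norm (a + c *\<^sub>R b))\<^sup>2 \<le> (1 + 1 / \<gamma>) * (norm a)\<^sup>2 + (1 + \<gamma>) * c\<^sup>2 * (norm b)\<^sup>2"
    for a b :: 'a
  proof -
    define v where "v = \<bar>c\<bar> * norm b"
    have "norm (a + c *\<^sub>R b) \<le> norm a + v"
      unfolding v_def by (rule order_trans[OF norm_triangle_ineq]) simp
    then have "(norm (a + c *\<^sub>R b))\<^sup>2 \<le> (norm a + v)\<^sup>2" by (rule power_mono) simp
    \<comment> \<open>The defect in Young's inequality is exactly this square.\<close>
    also have "\<dots> \<le> (norm a + v)\<^sup>2 + (norm a - \<gamma> * v)\<^sup>2 / \<gamma>" using \<gamma> by simp
    also have "\<dots> = (1 + 1 / \<gamma>) * (norm a)\<^sup>2 + (1 + \<gamma>) * v\<^sup>2"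
      using \<gamma> by (simp add: field_simps power2_eq_square)
    finally show ?thesis by (simp add: v_def power_mult_distrib mult.assoc)
  qed
  then show "AE u in P. (norm (X u + c *\<^sub>R Y u))\<^sup>2
      \<le> (1 + 1 / \<gamma>) * (norm (X u))\<^sup>2 + (1 + \<gamma>) * c\<^sup>2 * (norm (Y u))\<^sup>2"
    by simp
  have "(1 + 1 / \<gamma>) * (\<integral>u. (norm (X u))\<^sup>2 \<partial>P) \<le> (1 + 1 / \<gamma>) * A"
    using X \<gamma> by (intro mult_left_mono) (auto simp: second_moment_le_def)
  moreover have "(1 + \<gamma>) * c\<^sup>2 * (\<integral>u. (norm (Y u))\<^sup>2 \<partial>P) \<le> (1 + \<gamma>) * c\<^sup>2 * B"
    using Y \<gamma> by (intro mult_left_mono) (auto simp: second_moment_le_def)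
  ultimately show "(\<integral>u. (1 + 1 / \<gamma>) * (norm (X u))\<^sup>2 + (1 + \<gamma>) * c\<^sup>2 * (norm (Y u))\<^sup>2 \<partial>P)
      \<le> (1 + 1 / \<gamma>) * A + (1 + \<gamma>) * c\<^sup>2 * B"
    using X Y by (simp add: second_moment_le_def)
qed

text \<open>The reason is convexity of the squared norm, applied pointwise.\<close>

lemma second_moment_le_average:
  fixes X :: "nat \<Rightarrow> 'w \<Rightarrow> 'a::euclidean_space"
  assumes X: "\<And>i. i \<in> {1..M} \<Longrightarrow> second_moment_le P (X i) B" and M: "M \<ge> 1"
  shows "second_moment_le P (\<lambda>u. (1 / real M) *\<^sub>R (\<Sum>i=1..M. X i u)) B"
proof (rule second_moment_le_dominated)
  have "(\<lambda>u. \<Sum>i=1..M. X i u) \<in> borel_measurable P"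
    using X by (intro borel_measurable_sum) (simp add: second_moment_le_def)
  then show "(\<lambda>u. (1 / real M) *\<^sub>R (\<Sum>i=1..M. X i u)) \<in> borel_measurable P"
    by measurable
  show "integrable P (\<lambda>u. (1 / real M) * (\<Sum>i=1..M. (norm (X i u))\<^sup>2))"
    by (rule integrable_mult_right, rule Bochner_Integration.integrable_sum)
      (use X in \<open>simp add: second_moment_le_def\<close>)
  have "(norm ((1 / real M) *\<^sub>R (\<Sum>i=1..M. X i u)))\<^sup>2 \<le> (1 / real M) * (\<Sum>i=1..M. (norm (X i u))\<^sup>2)"
    for u
  proof -
    have "(norm (\<Sum>i=1..M. X i u))\<^sup>2 \<le> (\<Sum>i=1..M. norm (X i u))\<^sup>2"
      by (intro power_mono norm_sum norm_ge_zero)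
    also have "\<dots> \<le> (\<Sum>i=1..M. (norm (X i u))\<^sup>2) * real M"
      using sum_squared_le_sum_of_squares[of "\<lambda>i. norm (X i u)" "{1..M}"] by simp
    finally show ?thesis
      using M by (simp add: field_simps power2_eq_square)
  qed
  then show "AE u in P. (norm ((1 / real M) *\<^sub>R (\<Sum>i=1..M. X i u)))\<^sup>2
      \<le> (1 / real M) * (\<Sum>i=1..M. (norm (X i u))\<^sup>2)"
    by simp
  have "(\<integral>u. (1 / real M) * (\<Sum>i=1..M. (norm (X i u))\<^sup>2) \<partial>P)
      = (1 / real M) * (\<Sum>i=1..M. \<integral>u. (norm (X i u))\<^sup>2 \<partial>P)"
    using X by (subst integral_mult_right_zero, subst Bochner_Integration.integral_sum)
      (auto simp: second_moment_le_def)
  also have "\<dots> \<le> (1 / real M) * (\<Sum>i=1..M. B)"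
    using X by (intro mult_left_mono sum_mono) (auto simp: second_moment_le_def)
  also have "\<dots> = B" using M by simp
  finally show "(\<integral>u. (1 / real M) * (\<Sum>i=1..M. (norm (X i u))\<^sup>2) \<partial>P) \<le> B" .
qed

section \<open>Bounds on conditional second moments\<close>

lemma sigma_finite_subalgebra_of_prob_space:
  assumes "prob_space P" "subalgebra P F"
  shows "sigma_finite_subalgebra P F"
proof -
  interpret prob_space P by fact
  show ?thesis
    by (intro finite_measure_subalgebra_is_sigma_finite)
      (use assms in \<open>simp add: finite_measure_subalgebra_def finite_measure_subalgebra_axioms_def
         finite_measure_axioms\<close>)
qed

text \<open>Integrating a conditional bound removes the conditioning, since a conditional expectation has the
  same integral as its integrand. Working with \<open>nn_integral\<close> makes the finiteness of the second
  moment part of the conclusion.\<close>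

lemma second_moment_le_if_nn_cond_exp_le:
  fixes X :: "'w \<Rightarrow> 'a::euclidean_space"
  assumes P: "prob_space P" and F: "subalgebra P F" and X: "X \<in> borel_measurable P"
    and le: "AE u in P. nn_cond_exp P F (\<lambda>u. ennreal ((norm (X u))\<^sup>2)) u \<le> ennreal (h u)"
    and h: "integrable P h" "\<And>u. 0 \<le> h u" and B: "(\<integral>u. h u \<partial>P) \<le> B"
  shows "second_moment_le P X B"
proof -
  interpret F: sigma_finite_subalgebra P F using P F by (rule sigma_finite_subalgebra_of_prob_space)
  have "(\<integral>\<^sup>+ u. ennreal ((norm (X u))\<^sup>2) \<partial>P)
      = (\<integral>\<^sup>+ u. nn_cond_exp P F (\<lambda>u. ennreal ((norm (X u))\<^sup>2)) u \<partial>P)"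
    using F.nn_cond_exp_intg[of "\<lambda>_. 1" "\<lambda>u. ennreal ((norm (X u))\<^sup>2)"] X by simp
  also have "\<dots> \<le> (\<integral>\<^sup>+ u. ennreal (h u) \<partial>P)" by (rule nn_integral_mono_AE[OF le])
  also have "\<dots> = ennreal (\<integral>u. h u \<partial>P)" using h by (intro nn_integral_eq_integral) auto
  finally have nn: "(\<integral>\<^sup>+ u. ennreal ((norm (X u))\<^sup>2) \<partial>P) \<le> ennreal (\<integral>u. h u \<partial>P)" .
  have int: "integrable P (\<lambda>u. (norm (X u))\<^sup>2)"
    using X nn by (intro integrableI_bounded) (auto intro: le_less_trans)
  then have "ennreal (\<integral>u. (norm (X u))\<^sup>2 \<partial>P) \<le> ennreal (\<integral>u. h u \<partial>P)"
    using nn by (subst (asm) nn_integral_eq_integral) auto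
  then have "(\<integral>u. (norm (X u))\<^sup>2 \<partial>P) \<le> (\<integral>u. h u \<partial>P)"
    using h by (subst (asm) ennreal_le_iff) auto
  then show ?thesis using X int B by (auto simp: second_moment_le_def)
qed

lemma subalgebra_vimage_algebra:
  "f \<in> measurable P N \<Longrightarrow> subalgebra P (vimage_algebra (space P) f N)"
  unfolding subalgebra_def sets_vimage_algebra
  by (auto intro!: sets.sigma_sets_subset measurable_sets)

text \<open>The contraction in mean square that drives the whole argument: the compressor bound, conditional on
  the input, is integrated over the input.\<close>

lemma compression_error_second_moment:
  fixes p :: "'w \<Rightarrow> real^'d"
  assumes P: "prob_space P" and comp: "compresses_given_input P \<delta> C \<zeta> p" and \<delta>: "\<delta> \<le> 1"
    and meas: "(\<lambda>u. C (\<zeta> u) (p u)) \<in> borel_measurable P" and p: "second_moment_le P p B"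
  shows "second_moment_le P (\<lambda>u. p u - C (\<zeta> u) (p u)) ((1 - \<delta>) * B)"
proof (rule second_moment_le_if_nn_cond_exp_le[OF P])
  show "subalgebra P (vimage_algebra (space P) p borel)"
    using p by (intro subalgebra_vimage_algebra) (simp add: second_moment_le_def)
  show "(\<lambda>u. p u - C (\<zeta> u) (p u)) \<in> borel_measurable P"
    using p meas by (auto simp: second_moment_le_def)
  show "AE u in P. nn_cond_exp P (vimage_algebra (space P) p borel)
      (\<lambda>u. ennreal ((norm (p u - C (\<zeta> u) (p u)))\<^sup>2)) u \<le> ennreal ((1 - \<delta>) * (norm (p u))\<^sup>2)"
    using comp by (simp add: compresses_given_input_def norm_minus_commute)
  show "integrable P (\<lambda>u. (1 - \<delta>) * (norm (p u))\<^sup>2)"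
    using p by (simp add: second_moment_le_def)
  show "0 \<le> (1 - \<delta>) * (norm (p u))\<^sup>2" for u using \<delta> by simp
  show "(\<integral>u. (1 - \<delta>) * (norm (p u))\<^sup>2 \<partial>P) \<le> (1 - \<delta>) * B"
    using p \<delta> by (auto simp: second_moment_le_def intro: mult_left_mono)
qed

text \<open>Pythagoras in \<open>L\<^sup>2\<close>: a deviation from the conditional mean is orthogonal to the conditional mean, so
  the second moment is the sum of the second moments of the two parts. The expectation of the
  cross term exists because \<open>X\<close> is integrable and \<open>Y\<close> is bounded.\<close>

lemma second_moment_le_cond_mean:
  fixes X Y :: "'w \<Rightarrow> real^'d"
  assumes P: "prob_space P" and F: "subalgebra P F" and mean: "has_cond_mean P F X Y"
    and Y: "Y \<in> borel_measurable P"
    and var: "AE u in P. nn_cond_exp P F (\<lambda>u. ennreal ((norm (X u - Y u))\<^sup>2)) u \<le> ennreal (\<sigma>\<^sup>2)"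
    and bound: "AE u in P. (norm (Y u))\<^sup>2 \<le> \<omega>\<^sup>2"
  shows "second_moment_le P X (\<sigma>\<^sup>2 + \<omega>\<^sup>2)"
proof -
  interpret P: prob_space P by fact
  interpret F: sigma_finite_subalgebra P F using P F by (rule sigma_finite_subalgebra_of_prob_space)
  have X: "integrable P X" using mean by (simp add: has_cond_mean_def)
  then have Xm: "X \<in> borel_measurable P" by simp
  have dev: "second_moment_le P (\<lambda>u. X u - Y u) (\<sigma>\<^sup>2)"
    by (rule second_moment_le_if_nn_cond_exp_le[OF P F _ var]) (use Xm Y in \<open>auto simp: P.prob_space\<close>)
  have Y2: "second_moment_le P Y (\<omega>\<^sup>2)"
    by (rule second_moment_le_dominated[OF Y _ bound]) (auto simp: P.prob_space)
  have component: "(\<lambda>v :: real^'d. v $ k) \<in> borel_measurable borel" for k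
    by (intro borel_measurable_continuous_onI continuous_intros)
  have Xk_meas: "(\<lambda>u. X u $ k) \<in> borel_measurable P" for k
    using Xm component by (rule measurable_compose)
  have Yk_meas: "(\<lambda>u. Y u $ k) \<in> borel_measurable P" for k
    using Y component by (rule measurable_compose)
  have Xk: "integrable P (\<lambda>u. X u $ k)" for k
    by (rule Bochner_Integration.integrable_bound[OF integrable_norm[OF X]])
      (use Xk_meas component_le_norm_cart in \<open>auto\<close>)
  have Yk_le: "AE u in P. norm (Y u $ k) \<le> \<bar>\<omega>\<bar>" for k
    using bound
  proof eventually_elim
    case (elim u)
    then have "norm (Y u) \<le> \<bar>\<omega>\<bar>" by (simp add: abs_le_square_iff[symmetric])
    then show ?case using component_le_norm_cart[of "Y u" k] by simp
  qed
  have YX: "integrable P (\<lambda>u. Y u $ k * X u $ k)" for k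
    by (rule Bochner_Integration.integrable_bound
          [OF integrable_mult_right[OF integrable_norm[OF Xk[of k]], of "\<bar>\<omega>\<bar>"]])
      (use Xk_meas Yk_meas Yk_le[of k] in \<open>auto elim!: eventually_mono simp: abs_mult mult_right_mono\<close>)
  have YY: "integrable P (\<lambda>u. Y u $ k * Y u $ k)" for k
  proof (rule P.integrable_const_bound)
    show "AE u in P. norm (Y u $ k * Y u $ k) \<le> \<bar>\<omega>\<bar> * \<bar>\<omega>\<bar>"
      using Yk_le[of k] by eventually_elim (unfold norm_mult, rule mult_mono, simp_all)
    show "(\<lambda>u. Y u $ k * Y u $ k) \<in> borel_measurable P"
      using Yk_meas[of k] by (intro borel_measurable_times)
  qed
  \<comment> \<open>The components of \<open>Y\<close> agree almost everywhere with the conditional expectation \<open>Z\<close>, which is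
    measurable with respect to \<open>F\<close> and can therefore be pulled out.\<close>
  have orth: "(\<integral>u. Y u $ k * X u $ k \<partial>P) = (\<integral>u. Y u $ k * Y u $ k \<partial>P)" for k
  proof -
    define Z where "Z = real_cond_exp P F (\<lambda>u. X u $ k)"
    have Z: "AE u in P. Z u = Y u $ k" using mean by (simp add: has_cond_mean_def Z_def)
    have ZF: "Z \<in> borel_measurable F" by (simp add: Z_def)
    then have ZP: "Z \<in> borel_measurable P" by (simp add: Z_def)
    have ZX: "AE u in P. Y u $ k * X u $ k = Z u * X u $ k" using Z by auto
    have int: "integrable P (\<lambda>u. Z u * X u $ k)"
      using YX[of k] ZX by (subst integrable_cong_AE[symmetric]) (use ZP Xk_meas Yk_meas in auto)
    have "(\<integral>u. Y u $ k * X u $ k \<partial>P) = (\<integral>u. Z u * X u $ k \<partial>P)"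
      by (rule integral_cong_AE) (use ZX ZP Xk_meas Yk_meas in auto)
    also have "\<dots> = (\<integral>u. Z u * Z u \<partial>P)"
      using F.real_cond_exp_intg(2)[OF int ZF Xk_meas] by (simp add: Z_def)
    also have "\<dots> = (\<integral>u. Y u $ k * Y u $ k \<partial>P)"
      by (rule integral_cong_AE) (use Z ZP Yk_meas in auto)
    finally show ?thesis .
  qed
  \<comment> \<open>\<open>c\<close> is the cross term, the inner product of \<open>Y\<close> and \<open>X - Y\<close>.\<close>
  define c where "c u = (\<Sum>k\<in>UNIV. Y u $ k * X u $ k - Y u $ k * Y u $ k)" for u
  have c_int: "integrable P c" unfolding c_def using YX YY by auto
  have c_zero: "(\<integral>u. c u \<partial>P) = 0"
    unfolding c_def using YX YY orth by (subst Bochner_Integration.integral_sum) auto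
  show ?thesis
  proof (rule second_moment_le_dominated[OF Xm])
    show "integrable P (\<lambda>u. (norm (X u - Y u))\<^sup>2 + 2 * c u + (norm (Y u))\<^sup>2)"
      using dev Y2 c_int by (simp add: second_moment_le_def)
    have "(norm (X u))\<^sup>2 = (norm (X u - Y u))\<^sup>2 + 2 * c u + (norm (Y u))\<^sup>2" for u
    proof -
      have "c u = inner (Y u) (X u - Y u)"
        unfolding c_def inner_vec_def by (simp add: algebra_simps)
      then show ?thesis
        by (simp add: power2_norm_eq_inner inner_diff_left inner_diff_right inner_commute algebra_simps)
    qed
    then show "AE u in P. (norm (X u))\<^sup>2 \<le> (norm (X u - Y u))\<^sup>2 + 2 * c u + (norm (Y u))\<^sup>2"
      by simp
    show "(\<integral>u. (norm (X u - Y u))\<^sup>2 + 2 * c u + (norm (Y u))\<^sup>2 \<partial>P) \<le> \<sigma>\<^sup>2 + \<omega>\<^sup>2"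
      using dev Y2 c_int c_zero by (simp add: second_moment_le_def)
  qed
qed

section \<open>Error feedback\<close>

text \<open>One compressor with error feedback, abstracted from what it compresses: \<open>v\<close> is the incoming signal,
  \<open>q\<close> the compressor input and \<open>err\<close> the error that is carried over. The bound is stated for \<open>q\<close>
  because that of the error follows from it by the factor \<open>1 - \<delta>\<close>, and the compressor output is
  controlled through \<open>q\<close> as well. Its right-hand side \<open>Q\<^bsub>t\<^esub>\<close> solves the recursion
  \<open>Q\<^bsub>t+1\<^esub> = (2 - \<delta>) / \<delta> V\<^bsub>t+1\<^esub> + \<alpha> (\<eta>\<^bsub>t\<^esub> / \<eta>\<^bsub>t+1\<^esub>)\<^sup>2 Q\<^bsub>t\<^esub>\<close>.\<close>

lemma error_feedback_second_moment:
  fixes v q err :: "nat \<Rightarrow> 'w \<Rightarrow> 'a::euclidean_space" and V :: "nat \<Rightarrow> real"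
  assumes \<delta>: "0 < \<delta>" "\<delta> < 1" and \<alpha>: "\<alpha> = 1 - \<delta> / 2" and \<eta>: "\<And>t :: nat. \<eta> (int t) > 0"
    and q: "\<And>t u. u \<in> space P \<Longrightarrow> q t u = v t u + (\<eta> (int t - 1) / \<eta> (int t)) *\<^sub>R err t u"
    and err_0: "\<And>u. u \<in> space P \<Longrightarrow> err 0 u = 0"
    and err_Suc: "\<And>t B. second_moment_le P (q t) B \<Longrightarrow> second_moment_le P (err (Suc t)) ((1 - \<delta>) * B)"
    and v: "\<And>t. second_moment_le P (v t) (V t)"
  shows "second_moment_le P (q t)
           ((2 - \<delta>) / \<delta> * (\<Sum>j=0..t. \<alpha> ^ (t - j) * ((\<eta> (int j))\<^sup>2 / (\<eta> (int t))\<^sup>2) * V j))"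
proof (induction t)
  \<comment> \<open>Chosen such that Young's inequality uses up half of the gain \<open>\<delta>\<close> of the compressor.\<close>
  define \<gamma> where "\<gamma> = \<delta> / (2 * (1 - \<delta>))"
  have \<gamma>: "\<gamma> > 0" using \<delta> by (simp add: \<gamma>_def)
  have c1: "1 + 1 / \<gamma> = (2 - \<delta>) / \<delta>" using \<delta> by (simp add: \<gamma>_def field_simps)
  have c2: "(1 + \<gamma>) * (1 - \<delta>) = \<alpha>" using \<delta> by (simp add: \<gamma>_def \<alpha> field_simps)
  {
    case 0
    have "second_moment_le P (err 0) 0"
      using second_moment_le_cong[of P "err 0" "\<lambda>_. 0" 0] err_0 by (simp add: second_moment_le_def)
    from second_moment_le_add_scaleR[OF v[of 0] this \<gamma>, of "\<eta> (- 1) / \<eta> 0"]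
    have "second_moment_le P (\<lambda>u. v 0 u + (\<eta> (- 1) / \<eta> 0) *\<^sub>R err 0 u) ((2 - \<delta>) / \<delta> * V 0)"
      by (simp add: c1)
    then show ?case
      using \<eta>[of 0] second_moment_le_cong[of P "q 0"] q[of _ 0] by simp
  next
    case (Suc t)
    let ?S = "\<Sum>j=0..t. \<alpha> ^ (t - j) * ((\<eta> (int j))\<^sup>2 / (\<eta> (int t))\<^sup>2) * V j"
    let ?r = "\<eta> (int t) / \<eta> (int (Suc t))"
    have S: "(\<Sum>j=0..Suc t. \<alpha> ^ (Suc t - j) * ((\<eta> (int j))\<^sup>2 / (\<eta> (int (Suc t)))\<^sup>2) * V j)
      = \<alpha> * ?r\<^sup>2 * ?S + V (Suc t)"
    proof -
      have "(\<Sum>j=0..t. \<alpha> ^ (Suc t - j) * ((\<eta> (int j))\<^sup>2 / (\<eta> (int (Suc t)))\<^sup>2) * V j)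
        = \<alpha> * ?r\<^sup>2 * ?S"
        unfolding sum_distrib_left
        using \<eta>[of t] by (intro sum.cong) (auto simp: Suc_diff_le power_divide)
      then show ?thesis using \<eta>[of "Suc t"] by simp
    qed
    have "(1 + \<gamma>) * ?r\<^sup>2 * ((1 - \<delta>) * ((2 - \<delta>) / \<delta> * ?S)) = (2 - \<delta>) / \<delta> * (((1 + \<gamma>) * (1 - \<delta>)) * ?r\<^sup>2 * ?S)"
      by (simp only: mult_ac)
    then have B: "(1 + 1 / \<gamma>) * V (Suc t) + (1 + \<gamma>) * ?r\<^sup>2 * ((1 - \<delta>) * ((2 - \<delta>) / \<delta> * ?S))
      = (2 - \<delta>) / \<delta> * (\<alpha> * ?r\<^sup>2 * ?S + V (Suc t))"
      by (simp only: c1 c2 distrib_left add.commute)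
    from second_moment_le_add_scaleR[OF v[of "Suc t"] err_Suc[OF Suc.IH] \<gamma>, of ?r]
    have "second_moment_le P (\<lambda>u. v (Suc t) u + ?r *\<^sub>R err (Suc t) u)
        ((2 - \<delta>) / \<delta> * (\<alpha> * ?r\<^sup>2 * ?S + V (Suc t)))"
      unfolding B .
    then show ?case
      unfolding S using second_moment_le_cong[of P "q (Suc t)"] q[of _ "Suc t"] by simp
  }
qed

section \<open>Measurability of a run\<close>

text \<open>A gradient is a pointwise limit of difference quotients along the coordinate directions,
  each of which is continuous.\<close>

lemma borel_measurable_gradient:
  fixes f :: "'a::euclidean_space \<Rightarrow> real"
  assumes grad: "\<And>y. GDERIV f y :> G y"
  shows "G \<in> borel_measurable borel"
proof -
  have "continuous_on UNIV f"
    using grad by (auto simp: gderiv_def intro!: continuous_at_imp_continuous_on has_derivative_continuous)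
  then have f[measurable]: "f \<in> borel_measurable borel"
    by (rule borel_measurable_continuous_onI)
  have "(\<lambda>y. G y \<bullet> b) \<in> borel_measurable borel" for b
  proof (rule borel_measurable_LIMSEQ_real)
    fix y
    have "((\<lambda>s. f (y + s *\<^sub>R b)) has_derivative (\<lambda>s. (s *\<^sub>R b) \<bullet> G y)) (at 0)"
      by (rule has_derivative_compose[where f="\<lambda>s. y + s *\<^sub>R b" and g=f])
        (use grad in \<open>auto simp: gderiv_def intro!: derivative_eq_intros\<close>)
    then have "((\<lambda>s. f (y + s *\<^sub>R b)) has_field_derivative (G y \<bullet> b)) (at 0)"
      unfolding has_field_derivative_def
      by (rule has_derivative_eq_rhs) (auto simp: inner_commute mult.commute)
    then have "((\<lambda>h. (f (y + h *\<^sub>R b) - f y) / h) \<longlongrightarrow> G y \<bullet> b) (at 0)"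
      by (simp add: DERIV_def)
    moreover have "filterlim (\<lambda>n. inverse (real (Suc n))) (at 0) sequentially"
      using LIMSEQ_inverse_real_of_nat by (auto simp: filterlim_at)
    ultimately show "(\<lambda>n. (f (y + inverse (real (Suc n)) *\<^sub>R b) - f y) / inverse (real (Suc n)))
        \<longlonglongrightarrow> G y \<bullet> b"
      by (rule filterlim_compose)
  next
    show "(\<lambda>y. (f (y + inverse (real (Suc n)) *\<^sub>R b) - f y) / inverse (real (Suc n)))
        \<in> borel_measurable borel" for n
      by measurable
  qed
  then show ?thesis by (subst borel_measurable_euclidean_space) auto
qed

lemma (in dist_ef_sgd) compressor_output_measurable:
  assumes "a \<in> measurable P S" "b \<in> borel_measurable P"
  shows "(\<lambda>u. C (a u) (b u)) \<in> borel_measurable P"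
  using measurable_compose[OF measurable_Pair[OF assms] C_measurable] by simp

text \<open>The hypothesis on \<open>g\<close> comes from the unbiasedness assumption, which contains the integrability of
  \<open>g\<close>. The model update depends on the errors of all workers and of the server, which is why the
  induction carries the whole state.\<close>

lemma (in dist_ef_sgd) iterates_measurable:
  assumes g: "\<And>t i. i \<in> {1..M} \<Longrightarrow> g t i \<in> borel_measurable P"
  shows "x t \<in> borel_measurable P"
proof -
  have "(\<forall>i\<in>{1..M}. e t i \<in> borel_measurable P) \<and> es t \<in> borel_measurable P
      \<and> x t \<in> borel_measurable P"
  proof (induction t)
    case 0
    have "e 0 i \<in> borel_measurable P" if "i \<in> {1..M}" for i
      by (subst measurable_cong[OF e_init[OF that]]) auto
    moreover have "es 0 \<in> borel_measurable P" by (subst measurable_cong[OF es_init]) auto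
    moreover have "x 0 \<in> borel_measurable P" by (subst measurable_cong[OF x_init]) auto
    ultimately show ?case by blast
  next
    case (Suc t)
    then have [measurable]: "es t \<in> borel_measurable P" "x t \<in> borel_measurable P"
      and e: "\<And>i. i \<in> {1..M} \<Longrightarrow> e t i \<in> borel_measurable P"
      by blast+
    have p: "p t i \<in> borel_measurable P" if i: "i \<in> {1..M}" for i
    proof -
      note [measurable] = g[OF i] e[OF i]
      show ?thesis by (subst measurable_cong[OF p_eq[OF i]]) measurable
    qed
    have \<Delta>: "\<Delta> t i \<in> borel_measurable P" if i: "i \<in> {1..M}" for i
      using compressor_output_measurable[OF \<zeta>_measurable[OF i] p[OF i]]
      by (subst measurable_cong[OF \<Delta>_eq[OF i]])
    have [measurable]: "(\<lambda>u. \<Sum>i=1..M. \<Delta> t i u) \<in> borel_measurable P"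
      by (rule borel_measurable_sum) (rule \<Delta>)
    have ps [measurable]: "ps t \<in> borel_measurable P"
      by (subst measurable_cong[OF ps_eq]) measurable
    have [measurable]: "\<Delta>s t \<in> borel_measurable P"
      using compressor_output_measurable[OF \<zeta>s_measurable ps]
      by (subst measurable_cong[OF \<Delta>s_eq])
    have "e (Suc t) i \<in> borel_measurable P" if i: "i \<in> {1..M}" for i
    proof -
      note [measurable] = p[OF i] \<Delta>[OF i]
      show ?thesis by (subst measurable_cong[OF e_eq[OF i]]) measurable
    qed
    moreover have "es (Suc t) \<in> borel_measurable P"
      by (subst measurable_cong[OF es_eq]) measurable
    moreover have "x (Suc t) \<in> borel_measurable P"
      by (subst measurable_cong[OF x_eq]) measurable
    ultimately show ?case by blast
  qed
  then show ?thesis by blast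
qed

lemma (in dist_ef_sgd) subalgebra_history: "subalgebra P (history P D S M \<xi> \<zeta> \<zeta>s t)"
proof -
  let ?A = "\<Union>s<t. (\<Union>i\<in>{1..M}. sets (vimage_algebra (space P) (\<xi> s i) D) \<union>
                          sets (vimage_algebra (space P) (\<zeta> s i) S)) \<union>
             sets (vimage_algebra (space P) (\<zeta>s s) S)"
  have A: "?A \<subseteq> sets P"
    using subalgebra_vimage_algebra[OF \<xi>_measurable] subalgebra_vimage_algebra[OF \<zeta>_measurable]
      subalgebra_vimage_algebra[OF \<zeta>s_measurable]
    unfolding subalgebra_def by (intro UN_least Un_least) auto
  then have "?A \<subseteq> Pow (space P)" using sets.sets_into_space by blast
  then show ?thesis
    using A sets.sigma_sets_subset[OF A]
    unfolding subalgebra_def history_def by (simp add: sets_measure_of space_measure_of)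
qed

lemma (in dist_ef_sgd) stochastic_gradient_second_moment:
  assumes a2: "unbiased_bounded_variance P (history P D S M \<xi> \<zeta> \<zeta>s) M \<sigma> grad_f x g"
    and a3: "bounded_gradient P \<omega> grad_f x" and i: "i \<in> {1..M}"
  shows "second_moment_le P (g t i) (\<sigma>\<^sup>2 + \<omega>\<^sup>2)"
proof (rule second_moment_le_cond_mean[OF P.prob_space_axioms subalgebra_history])
  show "has_cond_mean P (history P D S M \<xi> \<zeta> \<zeta>s t) (g t i) (\<lambda>u. grad_f (x t u))"
    and "AE u in P. nn_cond_exp P (history P D S M \<xi> \<zeta> \<zeta>s t)
           (\<lambda>u. ennreal ((norm (g t i u - grad_f (x t u)))\<^sup>2)) u \<le> ennreal (\<sigma>\<^sup>2)"
    using a2 i by (auto simp: unbiased_bounded_variance_def)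
  show "AE u in P. (norm (grad_f (x t u)))\<^sup>2 \<le> \<omega>\<^sup>2"
    using a3 by (auto simp: bounded_gradient_def)
  have "g t i \<in> borel_measurable P" if "i \<in> {1..M}" for t i
    using a2 that unfolding unbiased_bounded_variance_def has_cond_mean_def
    by (blast intro: borel_measurable_integrable)
  then have "x t \<in> borel_measurable P" by (rule iterates_measurable)
  then show "(\<lambda>u. grad_f (x t u)) \<in> borel_measurable P"
    using borel_measurable_gradient[OF f_gradient] by (rule measurable_compose)
qed

section \<open>The accumulated error of a run\<close>

theorem theorem2:
  fixes P :: "'w measure" and D :: "'z measure" and S :: "'s measure"
    and L :: "real^'d \<Rightarrow> 'z \<Rightarrow> real"
    and grad_f :: "real^'d \<Rightarrow> real^'d"
    and C :: "'s \<Rightarrow> real^'d \<Rightarrow> real^'d"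
    and \<eta> :: "int \<Rightarrow> real"
    and M :: nat
    and \<xi> :: "nat \<Rightarrow> nat \<Rightarrow> 'w \<Rightarrow> 'z"
    and \<zeta> :: "nat \<Rightarrow> nat \<Rightarrow> 'w \<Rightarrow> 's"
    and \<zeta>s :: "nat \<Rightarrow> 'w \<Rightarrow> 's"
    and x0 :: "real^'d"
    and x :: "nat \<Rightarrow> 'w \<Rightarrow> real^'d"
    and g p \<Delta> e :: "nat \<Rightarrow> nat \<Rightarrow> 'w \<Rightarrow> real^'d"
    and ps \<Delta>s es :: "nat \<Rightarrow> 'w \<Rightarrow> real^'d"
    and \<delta> \<sigma> \<omega> G \<alpha> :: real
    and t :: nat
  assumes run: "dist_ef_sgd P D S L grad_f C \<eta> M \<xi> \<zeta> \<zeta>s x0 x g p \<Delta> e ps \<Delta>s es"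
    and workers: "M \<ge> 1"
    and delta: "0 < \<delta>" "\<delta> < 1"
    and compressor: "delta_compressor \<delta> S C"
    and compressor_workers:
      "\<And>t i. i \<in> {1..M} \<Longrightarrow> compresses_given_input P \<delta> C (\<zeta> t i) (p t i)"
    and compressor_server: "\<And>t. compresses_given_input P \<delta> C (\<zeta>s t) (ps t)"
    and eta_init: "\<eta> (-1) = 0"
    and eta_pos: "\<And>t :: nat. \<eta> (int t) > 0"
    and assumption2: "unbiased_bounded_variance P (history P D S M \<xi> \<zeta> \<zeta>s) M \<sigma> grad_f x g"
    and assumption3: "bounded_gradient P \<omega> grad_f x"
    and G: "G\<^sup>2 = \<sigma>\<^sup>2 + \<omega>\<^sup>2"
    and alpha: "\<alpha> = 1 - \<delta> / 2"
  shows "integrable P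
           (\<lambda>u. (norm (es (Suc t) u + (1 / real M) *\<^sub>R (\<Sum>i=1..M. e (Suc t) i u)))\<^sup>2) \<and>
         prob_space.expectation P
           (\<lambda>u. (norm (es (Suc t) u + (1 / real M) *\<^sub>R (\<Sum>i=1..M. e (Suc t) i u)))\<^sup>2)
         \<le> 2 * (1 - \<delta>) * (2 - \<delta>) * G\<^sup>2 / \<delta> *
             (\<Sum>k=0..t. (\<eta> (int t - int k))\<^sup>2 / (\<eta> (int t))\<^sup>2 * \<alpha> ^ k)
           + 4 * (1 - \<delta>) * (2 - \<delta>) ^ 3 * G\<^sup>2 / \<delta>\<^sup>2 *
             (\<Sum>j=0..t. \<alpha> ^ (t - j) *
                (\<Sum>k=0..j. (\<eta> (int j - int k))\<^sup>2 / (\<eta> (int t))\<^sup>2 * \<alpha> ^ k))"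
proof -
  interpret dist_ef_sgd P D S L grad_f C \<eta> M \<xi> \<zeta> \<zeta>s x0 x g p \<Delta> e ps \<Delta>s es by (rule run)
  have g2: "second_moment_le P (g t i) (G\<^sup>2)" if "i \<in> {1..M}" for t i
    unfolding G by (rule stochastic_gradient_second_moment[OF assumption2 assumption3 that])

  have e2: "second_moment_le P (e (Suc t) i) ((1 - \<delta>) * B)"
    if i: "i \<in> {1..M}" and B: "second_moment_le P (p t i) B" for t i B
  proof -
    have "p t i \<in> borel_measurable P" using B unfolding second_moment_le_def by blast
    from compression_error_second_moment[OF P.prob_space_axioms compressor_workers[OF i] less_imp_le[OF delta(2)]
        compressor_output_measurable[OF \<zeta>_measurable[OF i] this] B]
    have "second_moment_le P (\<lambda>u. p t i u - C (\<zeta> t i u) (p t i u)) ((1 - \<delta>) * B)" .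
    moreover have "e (Suc t) i u = p t i u - C (\<zeta> t i u) (p t i u)" if "u \<in> space P" for u
      by (simp only: e_eq[OF i that] \<Delta>_eq[OF i that])
    then have "second_moment_le P (e (Suc t) i) ((1 - \<delta>) * B)
      \<longleftrightarrow> second_moment_le P (\<lambda>u. p t i u - C (\<zeta> t i u) (p t i u)) ((1 - \<delta>) * B)"
      by (rule second_moment_le_cong)
    ultimately show ?thesis by (rule iffD2[rotated])
  qed
  have es2: "second_moment_le P (es (Suc t)) ((1 - \<delta>) * B)"
    if B: "second_moment_le P (ps t) B" for t B
  proof -
    have "ps t \<in> borel_measurable P" using B unfolding second_moment_le_def by blast
    from compression_error_second_moment[OF P.prob_space_axioms compressor_server less_imp_le[OF delta(2)]
        compressor_output_measurable[OF \<zeta>s_measurable this] B]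
    have "second_moment_le P (\<lambda>u. ps t u - C (\<zeta>s t u) (ps t u)) ((1 - \<delta>) * B)" .
    moreover have "es (Suc t) u = ps t u - C (\<zeta>s t u) (ps t u)" if "u \<in> space P" for u
      by (simp only: es_eq[OF that] \<Delta>s_eq[OF that])
    then have "second_moment_le P (es (Suc t)) ((1 - \<delta>) * B)
      \<longleftrightarrow> second_moment_le P (\<lambda>u. ps t u - C (\<zeta>s t u) (ps t u)) ((1 - \<delta>) * B)"
      by (rule second_moment_le_cong)
    ultimately show ?thesis by (rule iffD2[rotated])
  qed

  \<comment> \<open>First use of the error feedback lemma: every worker, with constant signal bound \<open>G\<^sup>2\<close>.\<close>
  define W where "W t = (2 - \<delta>) / \<delta> * (\<Sum>j=0..t. \<alpha> ^ (t - j) * ((\<eta> (int j))\<^sup>2 / (\<eta> (int t))\<^sup>2) * G\<^sup>2)" for t :: nat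
  have p2: "second_moment_le P (p t i) (W t)" if i: "i \<in> {1..M}" for t i
    unfolding W_def
    by (rule error_feedback_second_moment[where v="\<lambda>t. g t i" and err="\<lambda>t. e t i" and q="\<lambda>t. p t i",
          OF delta alpha eta_pos p_eq[OF i] e_init[OF i] e2[OF i] g2[OF i]])

  \<comment> \<open>The output is input minus error, whence the factor \<open>2 + 2 (1 - \<delta>) = 2 (2 - \<delta>)\<close>.\<close>
  have \<Delta>2: "second_moment_le P (\<Delta> t i) (2 * (2 - \<delta>) * W t)" if i: "i \<in> {1..M}" for t i
  proof -
    from second_moment_le_add_scaleR[OF p2[OF i, of t] e2[OF i p2[OF i]], of 1 "-1"]
    have "second_moment_le P (\<lambda>u. p t i u - e (Suc t) i u) (2 * W t + 2 * ((1 - \<delta>) * W t))"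
      by simp
    moreover have "2 * W t + 2 * ((1 - \<delta>) * W t) = 2 * (2 - \<delta>) * W t"
      by (simp add: algebra_simps)
    moreover have "second_moment_le P (\<Delta> t i) (2 * (2 - \<delta>) * W t)
      \<longleftrightarrow> second_moment_le P (\<lambda>u. p t i u - e (Suc t) i u) (2 * (2 - \<delta>) * W t)"
      by (rule second_moment_le_cong) (simp add: e_eq[OF i])
    ultimately show ?thesis by simp
  qed
  \<comment> \<open>Second use: the server, whose signal at time \<open>j\<close> is the average of the worker outputs.\<close>
  have ps2: "second_moment_le P (ps t)
      ((2 - \<delta>) / \<delta> * (\<Sum>j=0..t. \<alpha> ^ (t - j) * ((\<eta> (int j))\<^sup>2 / (\<eta> (int t))\<^sup>2) * (2 * (2 - \<delta>) * W j)))" for t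
    by (rule error_feedback_second_moment[where err=es and q=ps,
          OF delta alpha eta_pos ps_eq es_init es2 second_moment_le_average[OF \<Delta>2 workers]])

  \<comment> \<open>What remains is to bring the two bounds into the stated form: \<open>k\<close> counts backwards in time, and
    \<open>\<eta>\<^bsub>j\<^esub>\<^sup>2\<close> cancels between the outer and the inner sum.\<close>
  have W_eq: "W j = (2 - \<delta>) / \<delta> * G\<^sup>2 * (\<Sum>k=0..j. (\<eta> (int j - int k))\<^sup>2 / (\<eta> (int j))\<^sup>2 * \<alpha> ^ k)" for j
  proof -
    have "(\<Sum>i=0..j. \<alpha> ^ (j - i) * ((\<eta> (int i))\<^sup>2 / (\<eta> (int j))\<^sup>2) * G\<^sup>2)
      = (\<Sum>k=0..j. \<alpha> ^ k * ((\<eta> (int (j - k)))\<^sup>2 / (\<eta> (int j))\<^sup>2) * G\<^sup>2)"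
      by (rule sum.reindex_bij_witness[of _ "\<lambda>k. j - k" "\<lambda>k. j - k"]) auto
    also have "\<dots> = G\<^sup>2 * (\<Sum>k=0..j. (\<eta> (int j - int k))\<^sup>2 / (\<eta> (int j))\<^sup>2 * \<alpha> ^ k)"
      unfolding sum_distrib_left by (intro sum.cong) (auto simp: of_nat_diff mult_ac)
    finally show ?thesis by (simp add: W_def)
  qed
  have U_eq: "(\<Sum>j=0..t. \<alpha> ^ (t - j) * ((\<eta> (int j))\<^sup>2 / (\<eta> (int t))\<^sup>2) * (2 * (2 - \<delta>) * W j))
    = 2 * (2 - \<delta>)\<^sup>2 / \<delta> * G\<^sup>2 * (\<Sum>j=0..t. \<alpha> ^ (t - j) *
         (\<Sum>k=0..j. (\<eta> (int j - int k))\<^sup>2 / (\<eta> (int t))\<^sup>2 * \<alpha> ^ k))"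
    unfolding sum_distrib_left[of _ _ "{0..t}"]
  proof (intro sum.cong refl)
    fix j
    have inner: "(\<Sum>k=0..j. (\<eta> (int j - int k))\<^sup>2 / (\<eta> (int t))\<^sup>2 * \<alpha> ^ k)
      = (\<eta> (int j))\<^sup>2 / (\<eta> (int t))\<^sup>2 * (\<Sum>k=0..j. (\<eta> (int j - int k))\<^sup>2 / (\<eta> (int j))\<^sup>2 * \<alpha> ^ k)"
      unfolding sum_distrib_left using eta_pos[of j] by (intro sum.cong) auto
    show "\<alpha> ^ (t - j) * ((\<eta> (int j))\<^sup>2 / (\<eta> (int t))\<^sup>2) * (2 * (2 - \<delta>) * W j)
      = 2 * (2 - \<delta>)\<^sup>2 / \<delta> * G\<^sup>2 * (\<alpha> ^ (t - j) *
         (\<Sum>k=0..j. (\<eta> (int j - int k))\<^sup>2 / (\<eta> (int t))\<^sup>2 * \<alpha> ^ k))"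
      unfolding inner W_eq by (simp add: power2_eq_square mult_ac)
  qed

  from second_moment_le_add_scaleR[OF es2[OF ps2[of t]]
      second_moment_le_average[where X="e (Suc t)", OF e2[OF _ p2] workers], of 1 1]
  have fin: "second_moment_le P (\<lambda>u. es (Suc t) u + (1 / real M) *\<^sub>R (\<Sum>i=1..M. e (Suc t) i u))
      (2 * ((1 - \<delta>) * W t) + 2 * ((1 - \<delta>) * ((2 - \<delta>) / \<delta> *
        (\<Sum>j=0..t. \<alpha> ^ (t - j) * ((\<eta> (int j))\<^sup>2 / (\<eta> (int t))\<^sup>2) * (2 * (2 - \<delta>) * W j)))))"
    by (simp add: add.commute)
  have const1: "2 * ((1 - \<delta>) * ((2 - \<delta>) / \<delta> * G\<^sup>2 * s)) = 2 * (1 - \<delta>) * (2 - \<delta>) * G\<^sup>2 / \<delta> * s" for s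
    by simp
  have const2: "2 * ((1 - \<delta>) * ((2 - \<delta>) / \<delta> * (2 * (2 - \<delta>)\<^sup>2 / \<delta> * G\<^sup>2 * s)))
      = 4 * (1 - \<delta>) * (2 - \<delta>) ^ 3 * G\<^sup>2 / \<delta>\<^sup>2 * s" for s
    by (simp add: power2_eq_square power3_eq_cube)
  show ?thesis
    using fin unfolding second_moment_le_def U_eq unfolding W_eq const1 const2 by blast
qed

end
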